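(* Let $W=W(H_3)$ be the Coxeter group of type $H_3$ with longest element $w_o$ (which is central and acts as $-1$ in the reflection representation). The involutions in $W$ form exactly four conjugacy classes, namely the pairwise distinct classes $[w_\emptyset]$, $[w_{\{1,2,3\}}]$, $[w_{\{1\}}]=[w_{\{2\}}]$, $[w_{\{1,3\}}]$. Multiplication by $w_o=-1$ acts on these classes as follows: (1) it interchanges $[w_\emptyset]$ and $[w_{\{1,2,3\}}]$; (2) it interchanges $[w_{\{1\}}]$ and $[w_{\{1,3\}}]$.
   Context: The Coxeter graph $H_3$ is the path with nodes $1,2,3$, in which the edge between $1$ and $2$ has label $5$ and the edge between $2$ and $3$ has label $3$. Node $i$ corresponds to the simple generator $s_i$. For a set of nodes $I$, $W_I$ denotes the parabolic subgroup generated by $\{s_i: i\in I\}$, and $w_I$ denotes its longest element ($w_\emptyset=1$). An involution is an element $x$ with $x^2=1$ (the identity is included); $[x]$ denotes the conjugacy class of $x$ in $W$. *)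

theory Defs
  imports "HOL-Analysis.Analysis" "HOL-Algebra.Generated_Groups"
begin

text \<open>
  A Coxeter matrix has the nodes of the Coxeter graph as indices. The value 0 encodes the
  label infinity, i.e. the absence of a relation.
\<close>

definition coxeter_matrix :: "('n \<Rightarrow> 'n \<Rightarrow> nat) \<Rightarrow> bool" where
  "coxeter_matrix m \<longleftrightarrow> (\<forall>i j. m i j = m j i \<and> (m i j = 1 \<longleftrightarrow> i = j))"

text \<open>
  The Coxeter group is given by its presentation: generators \<open>s\<^sub>i\<close> and relations
  \<open>(s\<^sub>i s\<^sub>j)^(m i j) = 1\<close>. Since \<open>m i i = 1\<close>, the relations include \<open>s\<^sub>i s\<^sub>i = 1\<close>, so every
  generator is its own inverse and words without formal inverses suffice: the group is
  the free monoid of words modulo the congruence generated by the relations.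
\<close>

inductive cox_eq :: "('n \<Rightarrow> 'n \<Rightarrow> nat) \<Rightarrow> 'n list \<Rightarrow> 'n list \<Rightarrow> bool" for m where
  rel: "cox_eq m (concat (replicate (m i j) [i, j])) []"
| refl: "cox_eq m u u"
| sym: "cox_eq m u v \<Longrightarrow> cox_eq m v u"
| trans: "cox_eq m u v \<Longrightarrow> cox_eq m v w \<Longrightarrow> cox_eq m u w"
| cong: "cox_eq m u u' \<Longrightarrow> cox_eq m v v' \<Longrightarrow> cox_eq m (u @ v) (u' @ v')"

definition word_class :: "('n \<Rightarrow> 'n \<Rightarrow> nat) \<Rightarrow> 'n list \<Rightarrow> 'n list set" where
  "word_class m u = {v. cox_eq m u v}"

definition coxeter_group :: "('n \<Rightarrow> 'n \<Rightarrow> nat) \<Rightarrow> 'n list set monoid" where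
  "coxeter_group m =
    \<lparr>carrier = range (word_class m),
     mult = (\<lambda>A B. \<Union>u\<in>A. \<Union>v\<in>B. word_class m (u @ v)),
     one = word_class m []\<rparr>"

definition simple_gen :: "('n \<Rightarrow> 'n \<Rightarrow> nat) \<Rightarrow> 'n \<Rightarrow> 'n list set" where
  "simple_gen m i = word_class m [i]"

definition parabolic :: "('n \<Rightarrow> 'n \<Rightarrow> nat) \<Rightarrow> 'n set \<Rightarrow> 'n list set set" where
  "parabolic m I = generate (coxeter_group m) (simple_gen m ` I)"

definition cox_length :: "'n list set \<Rightarrow> nat" where
  "cox_length w = (LEAST n. \<exists>u\<in>w. length u = n)"

definition longest_element :: "('n \<Rightarrow> 'n \<Rightarrow> nat) \<Rightarrow> 'n set \<Rightarrow> 'n list set" where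
  "longest_element m I = (THE w. is_arg_max cox_length (\<lambda>x. x \<in> parabolic m I) w)"

definition involutions :: "('a, 'b) monoid_scheme \<Rightarrow> 'a set" where
  "involutions G = {x \<in> carrier G. x \<otimes>\<^bsub>G\<^esub> x = \<one>\<^bsub>G\<^esub>}"

definition conj_class :: "('a, 'b) monoid_scheme \<Rightarrow> 'a \<Rightarrow> 'a set" where
  "conj_class G x = {g \<otimes>\<^bsub>G\<^esub> x \<otimes>\<^bsub>G\<^esub> inv\<^bsub>G\<^esub> g | g. g \<in> carrier G}"

text \<open>
  The reflection representation on the space with basis \<open>axis i 1\<close> (the simple roots), with
  bilinear form \<open>B(axis i 1, axis j 1) = - cos (pi / m i j)\<close>. For \<open>m i j = 0\<close> (infinity)
  the convention \<open>x / 0 = 0\<close> gives the usual value \<open>-1\<close>.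
\<close>

definition cox_form :: "('n \<Rightarrow> 'n \<Rightarrow> nat) \<Rightarrow> real ^ 'n \<Rightarrow> real ^ 'n \<Rightarrow> real" where
  "cox_form m x y = (\<Sum>i\<in>UNIV. \<Sum>j\<in>UNIV. - cos (pi / real (m i j)) * (x $ i) * (y $ j))"

definition simple_reflection :: "('n::finite \<Rightarrow> 'n \<Rightarrow> nat) \<Rightarrow> 'n \<Rightarrow> real ^ 'n \<Rightarrow> real ^ 'n" where
  "simple_reflection m i v = v - (2 * cox_form m (axis i 1) v) *\<^sub>R axis i 1"

text \<open>
  All words representing \<open>w\<close> act in the same way, because the simple reflections satisfy the
  defining relations; \<open>the_elem\<close> picks this common action.
\<close>

definition reflection_rep :: "('n::finite \<Rightarrow> 'n \<Rightarrow> nat) \<Rightarrow> 'n list set \<Rightarrow> real ^ 'n \<Rightarrow> real ^ 'n" where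
  "reflection_rep m w = the_elem (foldr (simple_reflection m) ` w)"

text \<open>
  The nodes 1, 2, 3 of \<open>H\<^sub>3\<close> are the three elements of the numeral type \<open>3\<close>
  (where the numeral 3 is the same element as 0).
\<close>

definition H3 :: "3 \<Rightarrow> 3 \<Rightarrow> nat" where
  "H3 i j =
    (if i = j then 1 else if {i, j} = {1, 2} then 5 else if {i, j} = {2, 3} then 3 else 2)"

lemma coxeter_matrix_H3: "coxeter_matrix H3"
  by (simp add: coxeter_matrix_def H3_def insert_commute)

lemma word_class_eq_iff: "word_class m u = word_class m v \<longleftrightarrow> cox_eq m u v"
  by (auto simp: word_class_def intro: cox_eq.intros)

lemma mult_word_class:
  "word_class m u \<otimes>\<^bsub>coxeter_group m\<^esub> word_class m v = word_class m (u @ v)"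
  by (auto simp: coxeter_group_def word_class_def intro: cox_eq.intros)

lemma group_coxeter_group:
  assumes "coxeter_matrix m"
  shows "group (coxeter_group m)"
proof (rule groupI)
  have rev: "cox_eq m (rev u @ u) []" for u
  proof (induction u)
    case (Cons i u)
    have "m i i = 1" using assms by (simp only: coxeter_matrix_def)
    then have "cox_eq m [i, i] []" using cox_eq.rel[of m i i] by simp
    then have "cox_eq m (rev u @ [i, i] @ u) (rev u @ [] @ u)"
      by (intro cox_eq.cong cox_eq.refl)
    then show ?case using Cons.IH by (auto intro: cox_eq.trans)
  qed (simp add: cox_eq.refl)
  fix x assume "x \<in> carrier (coxeter_group m)"
  then obtain u where "x = word_class m u" by (auto simp: coxeter_group_def)
  then have "word_class m (rev u) \<otimes>\<^bsub>coxeter_group m\<^esub> x = \<one>\<^bsub>coxeter_group m\<^esub>"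
    using rev[of u] by (simp only: mult_word_class) (simp add: word_class_eq_iff coxeter_group_def)
  then show "\<exists>y\<in>carrier (coxeter_group m). y \<otimes>\<^bsub>coxeter_group m\<^esub> x = \<one>\<^bsub>coxeter_group m\<^esub>"
    by (intro bexI[of _ "word_class m (rev u)"]) (auto simp: coxeter_group_def)
next
  have carr: "carrier (coxeter_group m) = range (word_class m)"
    and one: "\<one>\<^bsub>coxeter_group m\<^esub> = word_class m []"
    by (simp_all add: coxeter_group_def)
  show "\<one>\<^bsub>coxeter_group m\<^esub> \<in> carrier (coxeter_group m)" by (simp add: carr one)
  fix x assume "x \<in> carrier (coxeter_group m)"
  then obtain u where u: "x = word_class m u" by (auto simp: carr)
  show "\<one>\<^bsub>coxeter_group m\<^esub> \<otimes>\<^bsub>coxeter_group m\<^esub> x = x" by (simp add: one u mult_word_class)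
  fix y assume "y \<in> carrier (coxeter_group m)"
  then obtain v where v: "y = word_class m v" by (auto simp: carr)
  show "x \<otimes>\<^bsub>coxeter_group m\<^esub> y \<in> carrier (coxeter_group m)"
    by (simp add: u v mult_word_class carr)
  fix z assume "z \<in> carrier (coxeter_group m)"
  then obtain w where w: "z = word_class m w" by (auto simp: carr)
  show "x \<otimes>\<^bsub>coxeter_group m\<^esub> y \<otimes>\<^bsub>coxeter_group m\<^esub> z =
      x \<otimes>\<^bsub>coxeter_group m\<^esub> (y \<otimes>\<^bsub>coxeter_group m\<^esub> z)"
    by (simp add: u v w mult_word_class)
qed

end

(*
The parabolic subgroup I_2(5) generated by s_1, s_2 has index 12 in W, so every element of W
can be brought into one of 10 * 12 = 120 normal forms. Right multiplication by the generators
defines an automaton on the normal forms; since the Coxeter relations act trivially on its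
states, the normal forms are pairwise distinct and geodesic, and every question about W becomes
a finite computation with states. The Coxeter element c = s_1 s_2 s_3 satisfies w_o = c^5, and
the 15 reflections are t_k s_(i_k) t_k^(-1), where t_k runs through the proper prefixes of the
reduced word c^5 and i_k is its next letter. The remaining involutions are 1, w_o and the
products of w_o with the reflections; parity of the length separates reflections from these.
*)
theory Submission
  imports Defs
begin

section \<open>Coxeter groups\<close>

lemma carrier_coxeter_group: "carrier (coxeter_group m) = range (word_class m)"
  and one_coxeter_group: "\<one>\<^bsub>coxeter_group m\<^esub> = word_class m []"
  by (simp_all add: coxeter_group_def)

lemma cox_eq_square:
  assumes "coxeter_matrix m"
  shows "cox_eq m [i, i] []"
proof -
  have "m i i = 1" using assms by (simp only: coxeter_matrix_def)
  then show ?thesis using cox_eq.rel[of m i i] by simp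
qed

lemma cox_eq_rev_append:
  assumes "coxeter_matrix m"
  shows "cox_eq m (u @ rev u) []"
proof (induction u rule: rev_induct)
  case (snoc i u)
  have "cox_eq m (u @ [i, i] @ rev u) (u @ [] @ rev u)"
    by (intro cox_eq.cong cox_eq.refl cox_eq_square assms)
  then show ?case using snoc.IH by (auto intro: cox_eq.trans)
qed (simp add: cox_eq.refl)

lemma inv_word_class:
  assumes "coxeter_matrix m"
  shows "inv\<^bsub>coxeter_group m\<^esub> word_class m u = word_class m (rev u)"
proof (rule group.inv_equality[OF group_coxeter_group[OF assms]])
  show "word_class m (rev u) \<otimes>\<^bsub>coxeter_group m\<^esub> word_class m u = \<one>\<^bsub>coxeter_group m\<^esub>"
    using cox_eq_rev_append[OF assms, of "rev u"]
    by (simp add: mult_word_class word_class_eq_iff one_coxeter_group)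
qed (auto simp: carrier_coxeter_group)

text \<open>Every generator is its own inverse, so the words in letters of \<open>I\<close>, without
  formal inverses, already give the whole generated subgroup.\<close>

lemma parabolic_eq:
  assumes "coxeter_matrix m"
  shows "parabolic m I = word_class m ` lists I"
proof (intro equalityI subsetI)
  fix x assume "x \<in> parabolic m I"
  then have "x \<in> generate (coxeter_group m) (simple_gen m ` I)"
    by (simp add: parabolic_def)
  then show "x \<in> word_class m ` lists I"
  proof induction
    case one
    show ?case by (simp add: one_coxeter_group)
  next
    case (incl h)
    then obtain i where "i \<in> I" "h = word_class m [i]" by (auto simp: simple_gen_def)
    then show ?case by (auto intro!: imageI)
  next
    case (inv h)
    then obtain i where "i \<in> I" "h = word_class m [i]" by (auto simp: simple_gen_def)
    then show ?case by (auto simp: inv_word_class[OF assms] intro!: imageI)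
  next
    case (eng h1 h2)
    then obtain u v where "u \<in> lists I" "v \<in> lists I" "h1 = word_class m u" "h2 = word_class m v"
      by blast
    then show ?case by (auto simp: mult_word_class intro!: imageI)
  qed
next
  fix x assume "x \<in> word_class m ` lists I"
  then obtain u where "u \<in> lists I" "x = word_class m u" by blast
  moreover have "word_class m u \<in> parabolic m I" using \<open>u \<in> lists I\<close>
  proof (induction u)
    case Nil
    show ?case using generate.one[of "coxeter_group m"] by (simp add: parabolic_def one_coxeter_group)
  next
    case (Cons i u)
    then have "simple_gen m i \<otimes>\<^bsub>coxeter_group m\<^esub> word_class m u \<in> parabolic m I"
      unfolding parabolic_def by (blast intro: generate.eng generate.incl)
    then show ?case by (simp add: simple_gen_def mult_word_class)
  qed
  ultimately show "x \<in> parabolic m I" by simp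
qed

text \<open>Every relator has even length \<open>2 * m i j\<close>, so the parity of words descends
  to the sign character of the group.\<close>

lemma cox_eq_even_length:
  assumes "coxeter_matrix m" "cox_eq m u v"
  shows "even (length u) \<longleftrightarrow> even (length v)"
  using assms(2)
  by induction (auto simp: length_concat sum_list_replicate)

text \<open>The strict inequality makes the maximiser unique, as the definite description
  requires.\<close>

lemma longest_element_eqI:
  assumes "w \<in> parabolic m I"
    and "\<And>x. x \<in> parabolic m I \<Longrightarrow> x \<noteq> w \<Longrightarrow> cox_length x < cox_length w"
  shows "longest_element m I = w"
  unfolding longest_element_def
  by (rule the_equality) (use assms in \<open>auto simp: is_arg_max_def dest: less_asym\<close>)

section \<open>Conjugacy classes\<close>

context group
begin

lemma conj_class_one: "conj_class G \<one> = {\<one>}"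
  by (auto simp: conj_class_def intro!: exI[of _ \<one>])

lemma conj_class_central:
  assumes "z \<in> carrier G" "\<And>x. x \<in> carrier G \<Longrightarrow> z \<otimes> x = x \<otimes> z"
  shows "conj_class G z = {z}"
proof -
  have "g \<otimes> z \<otimes> inv g = z" if "g \<in> carrier G" for g
    using assms that by (metis inv_solve_right m_closed)
  then show ?thesis by (force simp: conj_class_def)
qed

lemma conj_class_self: "x \<in> carrier G \<Longrightarrow> x \<in> conj_class G x"
  by (force simp: conj_class_def intro!: exI[of _ \<one>])

lemma conj_class_conj:
  assumes [simp]: "x \<in> carrier G" "g \<in> carrier G"
  shows "conj_class G (g \<otimes> x \<otimes> inv g) = conj_class G x"
proof -
  have sub: "conj_class G (h \<otimes> y \<otimes> inv h) \<subseteq> conj_class G y"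
    if [simp]: "y \<in> carrier G" "h \<in> carrier G" for y h
  proof
    fix a assume "a \<in> conj_class G (h \<otimes> y \<otimes> inv h)"
    then obtain k where [simp]: "k \<in> carrier G" and a: "a = k \<otimes> (h \<otimes> y \<otimes> inv h) \<otimes> inv k"
      by (auto simp: conj_class_def)
    have "a = (k \<otimes> h) \<otimes> y \<otimes> inv (k \<otimes> h)"
      by (simp add: a m_assoc inv_mult_group)
    then show "a \<in> conj_class G y" by (auto simp: conj_class_def)
  qed
  have "inv g \<otimes> (g \<otimes> x \<otimes> inv g) \<otimes> inv (inv g) = x"
    by (simp add: m_assoc) (simp add: m_assoc [symmetric])
  then show ?thesis using sub[of x g] sub[of "g \<otimes> x \<otimes> inv g" "inv g"] by simp
qed

lemma central_l_coset_conj_class: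
  assumes [simp]: "z \<in> carrier G" "x \<in> carrier G"
    and comm: "\<And>y. y \<in> carrier G \<Longrightarrow> z \<otimes> y = y \<otimes> z"
  shows "z <# conj_class G x = conj_class G (z \<otimes> x)"
proof -
  have "z \<otimes> (g \<otimes> x \<otimes> inv g) = g \<otimes> (z \<otimes> x) \<otimes> inv g" if [simp]: "g \<in> carrier G" for g
    using comm[of g] by (simp add: m_assoc [symmetric])
  then show ?thesis by (force simp: l_coset_def conj_class_def)
qed

end

section \<open>The automaton of normal forms\<close>

text \<open>Keeps the letter 1 from turning into \<open>Suc 0\<close>, so that the rewrite rules for
  \<open>lmul 1\<close> match.\<close>

declare One_nat_def [simp del]

text \<open>
  Words are written in the letters 1, 2, 3 of type nat, on which code_simp can compute. The
  state \<open>(k, c)\<close> stands for the \<open>k\<close>-th element on the 10-cycle that is the Cayley graph of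
  \<open>I\<^sub>2(5)\<close>, followed by the \<open>c\<close>-th of the minimal representatives of the right cosets
  of \<open>I\<^sub>2(5)\<close> in \<open>W\<close>.
\<close>

definition coset_reps :: "nat list list" where
  "coset_reps = [[], [3], [3,2], [3,2,1], [3,2,1,2], [3,2,1,2,1], [3,2,1,2,3], [3,2,1,2,1,3],
    [3,2,1,2,1,3,2], [3,2,1,2,1,3,2,1], [3,2,1,2,1,3,2,1,2], [3,2,1,2,1,3,2,1,2,3]]"

text \<open>
  If \<open>coset_step i ! c = (js, c')\<close>, then \<open>b\<^sub>c s\<^sub>i = js b\<^sub>c\<^sub>'\<close> for the coset representatives
  \<open>b\<close>, where \<open>js\<close> is empty or one letter in \<open>{1, 2}\<close>.
\<close>

definition coset_step :: "nat \<Rightarrow> (nat list \<times> nat) list" where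
  "coset_step i =
    (if i = 1 then [([1],0), ([1],1), ([],3), ([],2), ([],5), ([],4),
                    ([],7), ([],6), ([],9), ([],8), ([2],10), ([2],11)]
     else if i = 2 then [([2],0), ([],2), ([],1), ([],4), ([],3), ([1],5),
                    ([2],6), ([],8), ([],7), ([],10), ([],9), ([1],11)]
     else [([],1), ([],0), ([2],2), ([2],3), ([],6), ([],7),
                    ([],4), ([],5), ([1],8), ([1],9), ([],11), ([],10)])"

text \<open>Listed once around the cycle: up to the longest element at index 5 through words
  beginning with 1, then back down through words beginning with 2.\<close>

definition dih_reps :: "nat list list" where
  "dih_reps = [[], [1], [1,2], [1,2,1], [1,2,1,2], [1,2,1,2,1], [2,1,2,1], [2,1,2], [2,1], [2]]"

definition dih_step :: "nat \<Rightarrow> nat list" where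
  "dih_step i = (if i = 1 then [1,0,3,2,5,4,7,6,9,8] else [9,2,1,4,3,6,5,8,7,0])"

text \<open>From \<open>b_c s_i = js b_c'\<close> follows \<open>d b_c s_i = (d js) b_c'\<close>:
  the coset moves by the table and the dihedral part \<open>d\<close> absorbs
  \<open>js\<close>.\<close>

fun step :: "nat \<Rightarrow> nat \<times> nat \<Rightarrow> nat \<times> nat" where
  "step i (k, c) = (case coset_step i ! c of (js, c') \<Rightarrow> (fold (\<lambda>j k. dih_step j ! k) js k, c'))"

fun state_word :: "nat \<times> nat \<Rightarrow> nat list" where
  "state_word (k, c) = dih_reps ! k @ coset_reps ! c"

definition states :: "(nat \<times> nat) list" where
  "states = List.product [0..<10] [0..<12]"

definition nf :: "nat list \<Rightarrow> nat \<times> nat" where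
  "nf u = fold step u (0, 0)"

definition w0 :: "nat list" where
  "w0 = concat (replicate 5 [1, 2, 3])"

definition letters :: "nat list" where
  "letters = [1, 2, 3]"

text \<open>The sum of two distinct letters determines the pair: 3 stands for the edge between 1 and
  2, and 5 for the edge between 2 and 3.\<close>

definition H3_label :: "nat \<Rightarrow> nat \<Rightarrow> nat" where
  "H3_label i j =
    (if i = j then 1 else if i + j = 3 then 5 else if i + j = 5 then 3 else 2)"

lemma step_states: "\<forall>i\<in>set letters. \<forall>s\<in>set states. step i s \<in> set states"
  by code_simp

lemma length_step: "\<forall>i\<in>set letters. \<forall>s\<in>set states.
    length (state_word (step i s)) \<le> Suc (length (state_word s))"
  by code_simp

lemma fold_step_relation: "\<forall>i\<in>set letters. \<forall>j\<in>set letters. \<forall>s\<in>set states.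
    fold step (concat (replicate (H3_label i j) [i, j])) s = s"
  by code_simp

lemma set_state_word: "\<forall>s\<in>set states. \<forall>i\<in>set (state_word s). i \<in> set letters"
  by code_simp

lemma nf_w0_longest: "\<forall>s\<in>set states.
    s = nf w0 \<or> length (state_word s) < length (state_word (nf w0))"
  by code_simp

lemma nf_w0_central: "\<forall>i\<in>set letters. nf (w0 @ [i]) = nf (i # w0)"
  by code_simp

text \<open>The candidates are the identity, \<open>w0\<close>, the 15 reflections and their
  products with \<open>w0\<close>. Each reflection is written as a conjugate of a letter, from which
  its class can be read off.\<close>

lemma nf_involution: "\<forall>s\<in>set states. nf (state_word s @ state_word s) = (0, 0) \<longrightarrow>
    s \<in> set ([(0, 0), nf w0] @ map (\<lambda>k. nf (take k w0 @ [w0 ! k] @ rev (take k w0))) [0..<15]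
      @ map (\<lambda>k. nf (w0 @ take k w0 @ [w0 ! k] @ rev (take k w0))) [0..<15])"
  by code_simp

lemma zero_in_states: "(0, 0) \<in> set states"
  by (simp add: states_def)

lemma fold_step_states: "set u \<subseteq> set letters \<Longrightarrow> s \<in> set states \<Longrightarrow> fold step u s \<in> set states"
  by (induction u arbitrary: s) (use step_states in auto)

lemma nf_states: "set u \<subseteq> set letters \<Longrightarrow> nf u \<in> set states"
  unfolding nf_def by (intro fold_step_states zero_in_states)

lemma nf_snoc: "nf (u @ [i]) = step i (nf u)"
  by (simp add: nf_def)

lemma length_state_word_nf:
  "set u \<subseteq> set letters \<Longrightarrow> length (state_word (nf u)) \<le> length u"
proof (induction u rule: rev_induct)
  case Nil
  then show ?case by (simp add: nf_def dih_reps_def coset_reps_def)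
next
  case (snoc i u)
  then have "length (state_word (step i (nf u))) \<le> Suc (length (state_word (nf u)))"
    using length_step nf_states[of u] by auto
  with snoc show ?case by (simp add: nf_snoc)
qed

section \<open>Elements of the group as states\<close>

text \<open>In the type \<open>3\<close> the node 3 equals 0; \<open>index\<close> picks the letter
  3 for it and so inverts \<open>of_nat\<close> on the letters.\<close>

definition index :: "3 \<Rightarrow> nat" where
  "index i = (if i = 1 then 1 else if i = 2 then 2 else 3)"

definition elt :: "nat list \<Rightarrow> 3 list set" where
  "elt u = word_class H3 (map of_nat u)"

lemma of_nat_index: "of_nat (index i) = i"
  using exhaust_3[of i] by (auto simp: index_def)

lemma index_of_nat: "i \<in> set letters \<Longrightarrow> index (of_nat i) = i"
  by (auto simp: index_def letters_def)

lemma map_of_nat_index [simp]: "map (of_nat \<circ> index) x = x"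
  by (induction x) (auto simp: of_nat_index)

lemma map_index_of_nat: "set u \<subseteq> set letters \<Longrightarrow> map (index \<circ> of_nat) u = u"
  by (induction u) (auto simp: index_of_nat)

lemma index_letters: "index i \<in> set letters"
  by (simp add: index_def letters_def)

lemma set_map_index: "set (map index x) \<subseteq> set letters"
  by (auto simp: index_letters)

lemma elt_map_index: "elt (map index x) = word_class H3 x"
  by (simp add: elt_def)

lemma H3_eq_label: "H3 i j = H3_label (index i) (index j)"
  using exhaust_3[of i] exhaust_3[of j]
  by (auto simp: H3_def H3_label_def index_def doubleton_eq_iff)

text \<open>Relators fix every state, so the action of words on states factors through the group.
  The start state is arbitrary because in a product the second factor starts where the first one
  ended.\<close>

lemma fold_step_cox_eq:
  assumes "cox_eq H3 x y" "s \<in> set states"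
  shows "fold step (map index x) s = fold step (map index y) s"
  using assms
proof (induction arbitrary: s)
  case (rel i j)
  have "map index (concat (replicate n [i, j])) = concat (replicate n [index i, index j])" for n
    by (induction n) auto
  then show ?case using rel fold_step_relation index_letters by (simp add: H3_eq_label)
next
  case (cong u u' v v')
  then have "fold step (map index u) s \<in> set states"
    by (intro fold_step_states set_map_index)
  with cong show ?case by (simp add: cong.IH(2))
qed auto

lemma nf_eq_of_elt_eq:
  assumes "set u \<subseteq> set letters" "set v \<subseteq> set letters" "elt u = elt v"
  shows "nf u = nf v"
proof -
  have "cox_eq H3 (map of_nat u) (map of_nat v)"
    using assms(3) by (simp add: elt_def word_class_eq_iff)
  from fold_step_cox_eq[OF this zero_in_states] show ?thesis
    using assms(1,2) by (simp add: nf_def map_index_of_nat)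
qed

lemma elt_append_cong: "elt u = elt u' \<Longrightarrow> elt v = elt v' \<Longrightarrow> elt (u @ v) = elt (u' @ v')"
  by (simp add: elt_def word_class_eq_iff cox_eq.cong)

section \<open>Proving equations in the group by rewriting\<close>

lemma replicate_one: "replicate 1 x = [x]"
  by (simp add: One_nat_def)

lemma replicate_numeral: "replicate (numeral k) x = x # replicate (pred_numeral k) x"
  by (simp add: numeral_eq_Suc)

text \<open>
  Left multiplication is made total, acting as the identity off the carrier, so that the
  relations become unconditional rewrite rules.
\<close>

definition lmul :: "nat \<Rightarrow> 3 list set \<Rightarrow> 3 list set" where
  "lmul i A = (if A \<in> range (word_class H3)
    then word_class H3 [of_nat i] \<otimes>\<^bsub>coxeter_group H3\<^esub> A else A)"

lemma foldr_lmul_word_class: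
  "foldr lmul u (word_class H3 x) = word_class H3 (map of_nat u @ x)"
  by (induction u) (simp_all add: lmul_def mult_word_class)

lemma foldr_lmul_eq:
  assumes "elt u = elt v"
  shows "foldr lmul u A = foldr lmul v A"
proof (cases "A \<in> range (word_class H3)")
  case True
  then obtain x where "A = word_class H3 x" by blast
  moreover have "cox_eq H3 (map of_nat u @ x) (map of_nat v @ x)"
    using assms by (intro cox_eq.cong cox_eq.refl) (simp add: elt_def word_class_eq_iff)
  ultimately show ?thesis by (simp add: foldr_lmul_word_class word_class_eq_iff)
next
  case False
  then have "foldr lmul w A = A" for w by (induction w) (auto simp: lmul_def)
  then show ?thesis by simp
qed

text \<open>Turns equations between elements into equations between nested \<open>lmul\<close>
  terms, which the simplifier can reduce.\<close>

lemma elt_eq_foldr: "elt u = foldr lmul u (elt [])"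
  by (simp add: elt_def foldr_lmul_word_class)

lemma elt_relation: "elt (concat (replicate (H3 (of_nat i) (of_nat j)) [i, j])) = elt []"
proof -
  have "map of_nat (concat (replicate n [i, j])) = concat (replicate n [of_nat i, of_nat j :: 3])" for n
    by (induction n) auto
  then show ?thesis
    using cox_eq.rel[of H3 "of_nat i" "of_nat j"] by (simp only: elt_def word_class_eq_iff list.map)
qed

lemma lmul_relation:
  "foldr lmul (concat (replicate (H3 (of_nat i) (of_nat j)) [i, j])) A = A"
  using foldr_lmul_eq[OF elt_relation] by simp

lemma lmul_sq [simp]: "lmul i (lmul i A) = A"
  using lmul_relation[of i i] by (simp add: H3_def replicate_one)

lemma lmul_31 [simp]: "lmul 3 (lmul 1 A) = lmul 1 (lmul 3 A)"
proof -
  have "lmul 3 (lmul 1 (lmul 3 (lmul 1 B))) = B" for B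
    using lmul_relation[of 3 1] by (simp add: H3_def doubleton_eq_iff replicate_numeral replicate_one)
  \<comment> \<open>The argument starts with the inverse of the second half of the relator, so
    \<open>lmul_sq\<close> cancels that half. The other braid relations follow in the same
    way.\<close>
  from this[of "lmul 1 (lmul 3 A)"] show ?thesis by simp
qed

lemma lmul_323 [simp]: "lmul 3 (lmul 2 (lmul 3 A)) = lmul 2 (lmul 3 (lmul 2 A))"
proof -
  have "lmul 3 (lmul 2 (lmul 3 (lmul 2 (lmul 3 (lmul 2 B))))) = B" for B
    using lmul_relation[of 3 2] by (simp add: H3_def doubleton_eq_iff replicate_numeral replicate_one)
  from this[of "lmul 2 (lmul 3 (lmul 2 A))"] show ?thesis by simp
qed

lemma lmul_21212 [simp]: "lmul 2 (lmul 1 (lmul 2 (lmul 1 (lmul 2 A))))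
    = lmul 1 (lmul 2 (lmul 1 (lmul 2 (lmul 1 A))))"
proof -
  have "lmul 2 (lmul 1 (lmul 2 (lmul 1 (lmul 2 (lmul 1
      (lmul 2 (lmul 1 (lmul 2 (lmul 1 B))))))))) = B" for B
    using lmul_relation[of 2 1]
    by (simp add: H3_def doubleton_eq_iff replicate_numeral replicate_one)
  from this[of "lmul 1 (lmul 2 (lmul 1 (lmul 2 (lmul 1 A))))"] show ?thesis by simp
qed

text \<open>
  Together with the braid relations, the next three rules form a complete rewriting system,
  obtained by Knuth-Bendix completion with respect to the shortlex order.
\<close>

lemma lmul_3213 [simp]: "lmul 3 (lmul 2 (lmul 1 (lmul 3 A))) = lmul 2 (lmul 3 (lmul 2 (lmul 1 A)))"
  using lmul_323[of "lmul 1 A"] by simp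

lemma lmul_321232 [simp]:
  "lmul 3 (lmul 2 (lmul 1 (lmul 2 (lmul 3 (lmul 2 A)))))
    = lmul 2 (lmul 3 (lmul 2 (lmul 1 (lmul 2 (lmul 3 A)))))"
  \<comment> \<open>A critical pair: the word 321323 also ends in the braid word 323. With the
    instantiated rule switched off, the simplifier reduces this ending instead, and the two results
    give the new rule.\<close>
  using lmul_3213[of "lmul 2 (lmul 3 A)"] by (simp del: lmul_3213)

lemma lmul_3212132121 [simp]:
  "lmul 3 (lmul 2 (lmul 1 (lmul 2 (lmul 1 (lmul 3 (lmul 2 (lmul 1 (lmul 2 (lmul 1 A)))))))))
    = lmul 2 (lmul 3 (lmul 2 (lmul 1 (lmul 2 (lmul 1 (lmul 3 (lmul 2 (lmul 1 (lmul 2 A)))))))))"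
  using lmul_321232[of "lmul 1 (lmul 2 (lmul 1 (lmul 2 A)))"] by (simp del: lmul_321232)

section \<open>Normal forms and the word problem\<close>

lemma elt_dih_step:
  assumes "k < 10" "j = 1 \<or> j = 2"
  shows "elt (dih_reps ! k @ [j]) = elt (dih_reps ! (dih_step j ! k))"
proof -
  have "k \<in> {0, 1, 2, 3, 4, 5, 6, 7, 8, 9}" using assms(1) by (simp, presburger)
  then show ?thesis using assms(2)
    by (subst (1 2) elt_eq_foldr) (auto simp: dih_step_def dih_reps_def)
qed

text \<open>Verifies the table in the group itself: both words become nested \<open>lmul\<close>
  terms, which the rewriting system reduces to a common form.\<close>

lemma elt_coset_step:
  assumes "c < 12" "i \<in> set letters" "coset_step i ! c = (js, c')"
  shows "elt (coset_reps ! c @ [i]) = elt (js @ coset_reps ! c')"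
    and "js = [] \<or> js = [1] \<or> js = [2]"
proof -
  have c: "c \<in> {0, 1, 2, 3, 4, 5, 6, 7, 8, 9, 10, 11}" using assms(1) by (simp, presburger)
  show "elt (coset_reps ! c @ [i]) = elt (js @ coset_reps ! c')"
    using c assms(2,3) unfolding letters_def
    by (subst (1 2) elt_eq_foldr) (auto simp: coset_step_def coset_reps_def)
  show "js = [] \<or> js = [1] \<or> js = [2]"
    using c assms(2,3) unfolding letters_def by (auto simp: coset_step_def)
qed

lemma elt_state_word_step:
  assumes "s \<in> set states" "i \<in> set letters"
  shows "elt (state_word s @ [i]) = elt (state_word (step i s))"
proof -
  obtain k c where s: "s = (k, c)" "k < 10" "c < 12"
    using assms(1) by (auto simp: states_def)
  obtain js c' where st: "coset_step i ! c = (js, c')" by fastforce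
  note cs = elt_coset_step[OF s(3) assms(2) st]
  \<comment> \<open>Since \<open>js\<close> has at most one letter, a single step on the dihedral
    cycle suffices.\<close>
  have d: "elt (dih_reps ! k @ js) = elt (dih_reps ! fold (\<lambda>j k. dih_step j ! k) js k)"
    using cs(2) elt_dih_step[OF s(2)] by auto
  have "elt (state_word s @ [i]) = elt (dih_reps ! k @ js @ coset_reps ! c')"
    using elt_append_cong[OF HOL.refl cs(1), of "dih_reps ! k"] by (simp add: s)
  also have "\<dots> = elt (state_word (step i s))"
    using elt_append_cong[OF d HOL.refl, of "coset_reps ! c'"] by (simp add: s st)
  finally show ?thesis .
qed

lemma elt_state_word_nf:
  "set u \<subseteq> set letters \<Longrightarrow> elt (state_word (nf u)) = elt u"
proof (induction u rule: rev_induct)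
  case Nil
  show ?case by (simp add: nf_def dih_reps_def coset_reps_def)
next
  case (snoc i u)
  then have "elt (state_word (nf (u @ [i]))) = elt (state_word (nf u) @ [i])"
    by (simp add: nf_snoc elt_state_word_step nf_states)
  also have "\<dots> = elt (u @ [i])"
    using snoc by (intro elt_append_cong) auto
  finally show ?case .
qed

text \<open>Equal elements reach equal states because relators act trivially on states; conversely,
  the word of the state reached represents the element.\<close>

lemma elt_eq_iff:
  assumes "set u \<subseteq> set letters" "set v \<subseteq> set letters"
  shows "elt u = elt v \<longleftrightarrow> nf u = nf v"
  using assms nf_eq_of_elt_eq elt_state_word_nf by metis

text \<open>Packs the side conditions into one executable premise for
  \<open>code_simp\<close>.\<close>

lemma elt_eqI:
  assumes "list_all (\<lambda>i. i \<in> set letters) u \<and> list_all (\<lambda>i. i \<in> set letters) v \<and> nf u = nf v"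
  shows "elt u = elt v"
  using assms by (subst elt_eq_iff) (auto simp: list_all_iff)

lemma elt_cases:
  assumes "x \<in> carrier (coxeter_group H3)"
  obtains s where "s \<in> set states" "x = elt (state_word s)"
proof -
  obtain y where "x = elt (map index y)"
    using assms by (auto simp: carrier_coxeter_group elt_map_index)
  then show ?thesis
    using that nf_states elt_state_word_nf set_map_index by metis
qed

section \<open>Length and longest elements\<close>

lemma cox_length_elt:
  assumes "set u \<subseteq> set letters"
  shows "cox_length (elt u) = length (state_word (nf u))"
  unfolding cox_length_def
proof (rule Least_equality)
  have "map of_nat (state_word (nf u)) \<in> elt u"
    using elt_state_word_nf[OF assms, symmetric]
    by (simp add: elt_def word_class_eq_iff) (simp add: word_class_def)
  then show "\<exists>x\<in>elt u. length x = length (state_word (nf u))"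
    by (intro bexI) auto
next
  fix n assume "\<exists>x\<in>elt u. length x = n"
  then obtain x where x: "x \<in> elt u" "length x = n" by blast
  then have "elt u = elt (map index x)"
    by (simp add: elt_def word_class_eq_iff) (simp add: word_class_def)
  then have "nf u = nf (map index x)"
    by (intro nf_eq_of_elt_eq assms set_map_index)
  \<comment> \<open>No word of the class is shorter, since each letter read lengthens the normal
    form by at most one.\<close>
  then show "length (state_word (nf u)) \<le> n"
    using length_state_word_nf[OF set_map_index, of x] x(2) by simp
qed

text \<open>A set \<open>S\<close> of states that contains the identity and is closed under the
  letters of \<open>I\<close> contains the states of the whole parabolic subgroup, so the maximum is
  found by a finite check.\<close>

lemma longest_element_H3:
  assumes v: "v \<in> lists (set I)"
    and fin: "(0, 0) \<in> set S \<and> (\<forall>i\<in>set I. i \<in> set letters \<and> (\<forall>s\<in>set S. step i s \<in> set S))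
      \<and> (\<forall>s\<in>set S. s = nf v \<or> length (state_word s) < length (state_word (nf v)))"
  shows "longest_element H3 (of_nat ` set I) = elt v"
proof (rule longest_element_eqI)
  show "elt v \<in> parabolic H3 (of_nat ` set I)"
    using v by (auto simp: parabolic_eq[OF coxeter_matrix_H3] elt_def intro!: imageI)
next
  fix x assume "x \<in> parabolic H3 (of_nat ` set I)" and ne: "x \<noteq> elt v"
  then obtain y where y: "set y \<subseteq> of_nat ` set I" "x = elt (map index y)"
    by (auto simp: parabolic_eq[OF coxeter_matrix_H3] elt_map_index)
  have I: "set I \<subseteq> set letters" using fin by blast
  have sub: "set (map index y) \<subseteq> set I"
    using y(1) I index_of_nat by fastforce
  have v': "set v \<subseteq> set letters" using v I by auto
  have "fold step u s \<in> set S" if "set u \<subseteq> set I" "s \<in> set S" for u s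
    using that fin by (induction u arbitrary: s) auto
  then have "nf (map index y) \<in> set S" unfolding nf_def using sub fin by blast
  moreover have "nf (map index y) \<noteq> nf v"
    using ne y(2) elt_eq_iff[OF set_map_index v'] by simp
  ultimately have "length (state_word (nf (map index y))) < length (state_word (nf v))"
    using fin by blast
  then show "cox_length x < cox_length (elt v)"
    by (simp only: y(2) cox_length_elt[OF v'] cox_length_elt[OF set_map_index])
qed

lemma longest_element_empty: "longest_element H3 {} = elt []"
proof -
  have "longest_element H3 (of_nat ` set []) = elt []"
    by (rule longest_element_H3[where S = "[(0, 0)]"]) (simp, code_simp)
  then show ?thesis by simp
qed

lemma longest_element_1: "longest_element H3 {1} = elt [1]"
proof -
  have "longest_element H3 (of_nat ` set [1]) = elt [1]"
    by (rule longest_element_H3[where S = "[(0, 0), (1, 0)]"]) (simp, code_simp)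
  then show ?thesis by simp
qed

lemma longest_element_2: "longest_element H3 {2} = elt [2]"
proof -
  have "longest_element H3 (of_nat ` set [2]) = elt [2]"
    \<comment> \<open>\<open>(9, 0)\<close> is the state of the word \<open>[2]\<close>, which
      closes the dihedral cycle.\<close>
    by (rule longest_element_H3[where S = "[(0, 0), (9, 0)]"]) (simp, code_simp)
  then show ?thesis by simp
qed

lemma longest_element_13: "longest_element H3 {1, 3} = elt [1, 3]"
proof -
  have "longest_element H3 (of_nat ` set [1, 3]) = elt [1, 3]"
    \<comment> \<open>The states of the words \<open>[]\<close>, \<open>[1]\<close>,
      \<open>[3]\<close> and \<open>[1, 3]\<close>.\<close>
    by (rule longest_element_H3[where S = "[(0, 0), (1, 0), (0, 1), (1, 1)]"]) (simp, code_simp)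
  then show ?thesis by simp
qed

lemma set_w0: "set w0 \<subseteq> set letters"
  by (auto simp: w0_def letters_def)

lemma length_w0: "length w0 = 15"
  by code_simp

lemma longest_element_UNIV: "longest_element H3 UNIV = elt w0"
proof -
  have "(UNIV :: 3 set) = of_nat ` set letters" by (simp add: UNIV_3 letters_def)
  then show ?thesis
    using longest_element_H3[of w0 letters states]
      set_w0 zero_in_states step_states nf_w0_longest by auto
qed

section \<open>The reflection representation\<close>

text \<open>The golden ratio; the form takes the value \<open>- phi / 2\<close> on the edge labelled
  5.\<close>

definition phi :: real where
  "phi = 2 * cos (pi / 5)"

text \<open>For c = cos (pi / 5), the identity cos (3 pi / 5) = - cos (2 pi / 5) is a cubic
  equation. Its factor c + 1 is positive, and the remaining quadratic is the claim.\<close>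

lemma phi_sq: "phi * phi = phi + 1"
proof -
  define c where "c = cos (pi / 5)"
  have "c > 0" unfolding c_def using pi_gt_zero by (intro cos_gt_zero_pi) linarith+
  have "cos (3 * (pi / 5)) = - cos (2 * (pi / 5))"
    using cos_pi_minus[of "2 * (pi / 5)"] by (simp add: field_simps)
  then have "4 * c ^ 3 - 3 * c = - (2 * c ^ 2 - 1)"
    by (simp only: cos_treble_cos cos_double_cos c_def)
  then have "(c + 1) * (4 * c ^ 2 - 2 * c - 1) = 0"
    by (simp add: algebra_simps power2_eq_square power3_eq_cube)
  with \<open>c > 0\<close> have "4 * c ^ 2 - 2 * c - 1 = 0" by auto
  then show ?thesis by (simp add: phi_def c_def power2_eq_square)
qed

text \<open>Lets the simplifier lower powers of \<open>phi\<close> inside right-nested products as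
  well.\<close>

lemma phi_sq_left: "phi * (phi * x) = phi * x + x"
  using phi_sq by (metis distrib_right mult.assoc mult_1)

lemma simple_reflection_H3:
  "simple_reflection H3 1 (vector [a, b, c]) = vector [phi * b - a, b, c]"
  "simple_reflection H3 2 (vector [a, b, c]) = vector [a, phi * a + c - b, c]"
  "simple_reflection H3 3 (vector [a, b, c]) = vector [a, b, b - c]"
  by (simp_all add: vec_eq_iff forall_3 simple_reflection_def cox_form_def sum_3 axis_def
      H3_def doubleton_eq_iff phi_def cos_60)

lemma vec3_cases:
  fixes v :: "real ^ 3"
  obtains a b c where "v = vector [a, b, c]"
proof
  show "v = vector [v $ 1, v $ 2, v $ 3]" by (simp add: vec_eq_iff forall_3)
qed

lemma foldr_simple_reflection_relation:
  "foldr (simple_reflection H3) (concat (replicate (H3 i j) [i, j])) v = v"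
proof -
  obtain a b c where v: "v = vector [a, b, c]" by (rule vec3_cases)
  show ?thesis
    using exhaust_3[of i] exhaust_3[of j]
    by (auto simp: v H3_def doubleton_eq_iff replicate_numeral replicate_one simple_reflection_H3
        phi_sq phi_sq_left algebra_simps)
qed

lemma foldr_simple_reflection_cox_eq:
  "cox_eq H3 x y \<Longrightarrow> foldr (simple_reflection H3) x v = foldr (simple_reflection H3) y v"
proof (induction arbitrary: v rule: cox_eq.induct)
  case (rel i j)
  then show ?case using foldr_simple_reflection_relation by simp
qed auto

lemma reflection_rep_word_class:
  "reflection_rep H3 (word_class H3 x) = foldr (simple_reflection H3) x"
proof -
  have "foldr (simple_reflection H3) ` word_class H3 x = {foldr (simple_reflection H3) x}"
    using foldr_simple_reflection_cox_eq cox_eq.refl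
    by (fastforce simp: word_class_def)
  then show ?thesis by (simp add: reflection_rep_def)
qed

lemma reflection_rep_w0: "reflection_rep H3 (elt w0) v = - v"
proof -
  obtain a b c where v: "v = vector [a, b, c]" by (rule vec3_cases)
  have cox: "foldr (simple_reflection H3) [1, 2, 3] (vector [a, b, c])
      = vector [phi * a - phi * c, phi * a - c, b - c]" for a b c
    by (simp add: simple_reflection_H3 phi_sq_left algebra_simps)
  have "reflection_rep H3 (elt w0) v
      = (foldr (simple_reflection H3) [1, 2, 3] ^^ 5) (vector [a, b, c])"
    by (simp add: elt_def reflection_rep_word_class w0_def eval_nat_numeral One_nat_def v)
  also have "\<dots> = vector [- a, - b, - c]"
    \<comment> \<open>Without \<open>foldr.simps\<close> the Coxeter element stays one block, to
      which \<open>cox\<close> applies five times.\<close>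
    by (simp add: eval_nat_numeral One_nat_def cox phi_sq_left algebra_simps del: foldr.simps)
  also have "\<dots> = - v" by (simp add: v vec_eq_iff forall_3)
  finally show ?thesis .
qed

section \<open>The conjugacy classes of involutions\<close>

interpretation H3: group "coxeter_group H3"
  by (rule group_coxeter_group) (rule coxeter_matrix_H3)

lemma elt_closed [simp]: "elt u \<in> carrier (coxeter_group H3)"
  by (simp add: elt_def carrier_coxeter_group)

lemma elt_mult: "elt u \<otimes>\<^bsub>coxeter_group H3\<^esub> elt v = elt (u @ v)"
  by (simp add: elt_def mult_word_class)

lemma elt_Nil: "elt [] = \<one>\<^bsub>coxeter_group H3\<^esub>"
  by (simp add: elt_def one_coxeter_group)

lemma inv_elt: "inv\<^bsub>coxeter_group H3\<^esub> elt u = elt (rev u)"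
  by (simp add: elt_def inv_word_class[OF coxeter_matrix_H3] rev_map)

lemma elt_w0_central:
  assumes "x \<in> carrier (coxeter_group H3)"
  shows "elt w0 \<otimes>\<^bsub>coxeter_group H3\<^esub> x = x \<otimes>\<^bsub>coxeter_group H3\<^esub> elt w0"
proof -
  have gen: "elt (w0 @ [i]) = elt ([i] @ w0)" if "i \<in> set letters" for i
    using that nf_w0_central set_w0 by (subst elt_eq_iff) auto
  have "elt (w0 @ u) = elt (u @ w0)" if "set u \<subseteq> set letters" for u
    using that
  proof (induction u)
    case (Cons i u)
    have "elt (w0 @ i # u) = elt ([i] @ w0 @ u)"
      using elt_append_cong[OF gen HOL.refl, of i u] Cons.prems by simp
    also have "\<dots> = elt ([i] @ u @ w0)"
      using Cons by (intro elt_append_cong[OF HOL.refl]) auto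
    finally show ?case by simp
  qed simp
  moreover obtain s where "s \<in> set states" "x = elt (state_word s)"
    using elt_cases[OF assms] .
  ultimately show ?thesis using set_state_word by (auto simp: elt_mult)
qed

lemma conj_class_elt_conj:
  "conj_class (coxeter_group H3) (elt (t @ u @ rev t)) = conj_class (coxeter_group H3) (elt u)"
  using H3.conj_class_conj[of "elt u" "elt t"] by (simp add: inv_elt elt_mult)

lemma conj_class_elt_w0:
  "elt w0 <#\<^bsub>coxeter_group H3\<^esub> conj_class (coxeter_group H3) (elt u)
    = conj_class (coxeter_group H3) (elt (w0 @ u))"
  by (simp add: H3.central_l_coset_conj_class elt_w0_central elt_mult)

lemma conj_class_generators:
  assumes "i \<in> set letters"
  shows "conj_class (coxeter_group H3) (elt [i]) = conj_class (coxeter_group H3) (elt [1])"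
proof -
  \<comment> \<open>The edge labels 5 and 3 are odd, so generators joined by an edge are conjugate;
    explicit conjugators are checked on states.\<close>
  have "elt [2] = elt ([1,2,1,2] @ [1] @ rev [1,2,1,2])" by (rule elt_eqI) code_simp
  moreover have "elt [3] = elt ([2,1,3,2,1,2] @ [1] @ rev [2,1,3,2,1,2])" by (rule elt_eqI) code_simp
  ultimately show ?thesis
    using assms by (simp only: letters_def) (auto simp only: conj_class_elt_conj list.set)
qed

text \<open>Minus a reflection is a half-turn, as is the product of the orthogonal reflections
  \<open>s_1\<close> and \<open>s_3\<close>; an explicit conjugator links the two.\<close>

lemma conj_class_w0_1:
  "conj_class (coxeter_group H3) (elt (w0 @ [1])) = conj_class (coxeter_group H3) (elt [1, 3])"
proof -
  have "elt (w0 @ [1]) = elt ([2,1,3,2,1,2] @ [1,3] @ rev [2,1,3,2,1,2])" by (rule elt_eqI) code_simp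
  then show ?thesis by (simp only: conj_class_elt_conj)
qed

lemma conj_class_w0_13:
  "conj_class (coxeter_group H3) (elt (w0 @ [1, 3])) = conj_class (coxeter_group H3) (elt [1])"
proof -
  have "elt (w0 @ [1, 3]) = elt ([2,1,2,1,3,2] @ [1] @ rev [2,1,2,1,3,2])" by (rule elt_eqI) code_simp
  then show ?thesis by (simp only: conj_class_elt_conj)
qed

lemma elt_w0_sq: "elt (w0 @ w0) = elt []"
  by (rule elt_eqI) code_simp

lemma conj_class_involution:
  assumes "x \<in> involutions (coxeter_group H3)"
  shows "conj_class (coxeter_group H3) x
    \<in> conj_class (coxeter_group H3) ` {elt [], elt w0, elt [1], elt [1, 3]}"
proof -
  let ?cl = "conj_class (coxeter_group H3)"
  obtain s where s: "s \<in> set states" and x: "x = elt (state_word s)"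
    using assms elt_cases by (auto simp: involutions_def)
  have sw: "set (state_word s) \<subseteq> set letters" using s set_state_word by blast
  have "elt (state_word s @ state_word s) = elt []"
    using assms by (simp add: involutions_def x elt_mult elt_Nil)
  then have "nf (state_word s @ state_word s) = nf []"
    using sw by (intro nf_eq_of_elt_eq) auto
  then have "s \<in> set ([(0, 0), nf w0] @ map (\<lambda>k. nf (take k w0 @ [w0 ! k] @ rev (take k w0))) [0..<15]
      @ map (\<lambda>k. nf (w0 @ take k w0 @ [w0 ! k] @ rev (take k w0))) [0..<15])"
    using s nf_involution by (simp add: nf_def)
  then consider "s = nf []" | "s = nf w0"
    | k where "k < 15" "s = nf (take k w0 @ [w0 ! k] @ rev (take k w0))"
    | k where "k < 15" "s = nf (w0 @ take k w0 @ [w0 ! k] @ rev (take k w0))"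
    by (auto simp: nf_def)
  then show ?thesis
  proof cases
    case 1
    then show ?thesis using elt_state_word_nf[of "[]"] by (simp add: x)
  next
    case 2
    then show ?thesis using elt_state_word_nf[OF set_w0] by (simp add: x)
  next
    case (3 k)
    have k: "w0 ! k \<in> set letters"
      using set_w0 3(1) nth_mem[of k w0] by (auto simp: length_w0)
    have "set (take k w0 @ [w0 ! k] @ rev (take k w0)) \<subseteq> set letters"
      using k set_w0 set_take_subset[of k w0] by auto
    then have "?cl x = ?cl (elt [w0 ! k])"
      by (simp only: x 3(2) elt_state_word_nf conj_class_elt_conj)
    then show ?thesis using conj_class_generators[OF k] by simp
  next
    case (4 k)
    have k: "w0 ! k \<in> set letters"
      using set_w0 4(1) nth_mem[of k w0] by (auto simp: length_w0)
    have "set (w0 @ take k w0 @ [w0 ! k] @ rev (take k w0)) \<subseteq> set letters"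
      using k set_w0 set_take_subset[of k w0] by auto
    \<comment> \<open>The central factor \<open>w0\<close> is first taken out of the class; what
      remains is a conjugate of a letter.\<close>
    then have "?cl x = elt w0 <#\<^bsub>coxeter_group H3\<^esub> ?cl (elt [w0 ! k])"
      by (simp only: x 4(2) elt_state_word_nf conj_class_elt_conj conj_class_elt_w0 [symmetric])
    then show ?thesis
      using conj_class_generators[OF k] by (simp only: conj_class_elt_w0 conj_class_w0_1) simp
  qed
qed

text \<open>Conjugating by \<open>x\<close> adds twice the length of \<open>x\<close> to a word, so
  the sign character is constant on classes.\<close>

lemma conj_class_eq_even_length:
  assumes "conj_class (coxeter_group H3) (elt u) = conj_class (coxeter_group H3) (elt v)"
  shows "even (length u) \<longleftrightarrow> even (length v)"
proof -
  have "elt u \<in> conj_class (coxeter_group H3) (elt v)"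
    using H3.conj_class_self[of "elt u"] assms by simp
  then obtain x where "elt u = word_class H3 x \<otimes>\<^bsub>coxeter_group H3\<^esub> elt v
      \<otimes>\<^bsub>coxeter_group H3\<^esub> inv\<^bsub>coxeter_group H3\<^esub> word_class H3 x"
    by (auto simp: conj_class_def carrier_coxeter_group)
  then have "cox_eq H3 (map of_nat u) (x @ map of_nat v @ rev x)"
    by (simp add: elt_def inv_word_class[OF coxeter_matrix_H3] mult_word_class word_class_eq_iff)
  from cox_eq_even_length[OF coxeter_matrix_H3 this] show ?thesis by auto
qed

lemma conj_class_w0: "conj_class (coxeter_group H3) (elt w0) = {elt w0}"
  by (simp add: H3.conj_class_central elt_w0_central)

lemma conj_class_Nil: "conj_class (coxeter_group H3) (elt []) = {elt []}"
  by (simp add: elt_Nil H3.conj_class_one)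

lemma elt_neqs: "elt [1, 3] \<noteq> elt []" "elt [1] \<noteq> elt w0"
proof -
  have "nf [1, 3] \<noteq> nf []" by code_simp
  then show "elt [1, 3] \<noteq> elt []"
    using nf_eq_of_elt_eq[of "[1, 3]" "[]"] by (auto simp: letters_def)
  have "nf [1] \<noteq> nf w0" by code_simp
  moreover have "set [1] \<subseteq> set letters" by (simp add: letters_def)
  ultimately show "elt [1] \<noteq> elt w0"
    using nf_eq_of_elt_eq[OF _ set_w0] by blast
qed

text \<open>Parity separates four of the six pairs. In each of the other two, one class is the
  singleton of a central element.\<close>

lemma distinct_conj_classes:
  "distinct (map (\<lambda>u. conj_class (coxeter_group H3) (elt u)) [[], w0, [1], [1, 3]])"
proof -
  let ?cl = "\<lambda>u. conj_class (coxeter_group H3) (elt u)"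
  have "odd (length w0)" by (simp add: length_w0)
  then have "?cl [] \<noteq> ?cl w0" "?cl [] \<noteq> ?cl [1]" "?cl w0 \<noteq> ?cl [1, 3]" "?cl [1] \<noteq> ?cl [1, 3]"
    using conj_class_eq_even_length[of "[]" w0] conj_class_eq_even_length[of "[]" "[1]"]
      conj_class_eq_even_length[of w0 "[1, 3]"] conj_class_eq_even_length[of "[1]" "[1, 3]"]
    by auto
  moreover have "?cl [] \<noteq> ?cl [1, 3]" "?cl w0 \<noteq> ?cl [1]"
    using H3.conj_class_self[of "elt [1, 3]"] H3.conj_class_self[of "elt [1]"] elt_neqs
    by (auto simp: conj_class_Nil conj_class_w0)
  ultimately show ?thesis by (simp)
qed

lemma elt_involutions:
  "{elt [], elt w0, elt [1], elt [1, 3]} \<subseteq> involutions (coxeter_group H3)"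
proof -
  have "elt ([1] @ [1]) = elt []" by (rule elt_eqI) code_simp
  moreover have "elt ([1, 3] @ [1, 3]) = elt []" by (rule elt_eqI) code_simp
  ultimately show ?thesis using elt_w0_sq
    by (simp add: involutions_def elt_mult elt_Nil [symmetric])
qed

theorem mainTheorem10:
  defines "W \<equiv> coxeter_group H3"
  defines "w \<equiv> longest_element H3"
  defines "w\<^sub>o \<equiv> longest_element H3 UNIV"
  defines "cl \<equiv> conj_class W"
  shows "w\<^sub>o \<in> carrier W \<and> (\<forall>x\<in>carrier W. w\<^sub>o \<otimes>\<^bsub>W\<^esub> x = x \<otimes>\<^bsub>W\<^esub> w\<^sub>o)
    \<and> (\<forall>v. reflection_rep H3 w\<^sub>o v = - v)
    \<and> cl ` involutions W = {cl (w {}), cl (w {1, 2, 3}), cl (w {1}), cl (w {1, 3})}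
    \<and> distinct [cl (w {}), cl (w {1, 2, 3}), cl (w {1}), cl (w {1, 3})]
    \<and> cl (w {1}) = cl (w {2})
    \<and> w\<^sub>o <#\<^bsub>W\<^esub> cl (w {}) = cl (w {1, 2, 3})
    \<and> w\<^sub>o <#\<^bsub>W\<^esub> cl (w {1, 2, 3}) = cl (w {})
    \<and> w\<^sub>o <#\<^bsub>W\<^esub> cl (w {1}) = cl (w {1, 3})
    \<and> w\<^sub>o <#\<^bsub>W\<^esub> cl (w {1, 3}) = cl (w {1})"
proof -
  have w: "w {} = elt []" "w {1, 2, 3} = elt w0" "w {1} = elt [1]" "w {2} = elt [2]"
      "w {1, 3} = elt [1, 3]" "w\<^sub>o = elt w0"
    using longest_element_empty longest_element_UNIV longest_element_1 longest_element_2
      longest_element_13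
    by (simp_all add: w_def w\<^sub>o_def UNIV_3)
  have "cl ` involutions W = cl ` {elt [], elt w0, elt [1], elt [1, 3]}"
    using conj_class_involution elt_involutions unfolding W_def cl_def by blast
  moreover have "distinct (map (\<lambda>u. cl (elt u)) [[], w0, [1], [1, 3]])"
    using distinct_conj_classes unfolding W_def cl_def .
  moreover have "cl (elt [2]) = cl (elt [1])"
    using conj_class_generators[of 2] by (simp add: W_def cl_def letters_def)
  \<comment> \<open>The cases \<open>[]\<close>, \<open>w0\<close>, \<open>[1]\<close> and
    \<open>[1, 3]\<close> of \<open>u\<close> give the four products; for \<open>w0\<close> it
    remains to use that its square is the identity.\<close>
  moreover have "elt w0 <#\<^bsub>W\<^esub> cl (elt u) = cl (elt (w0 @ u))" for u
    unfolding W_def cl_def by (rule conj_class_elt_w0)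
  moreover have "cl (elt (w0 @ [1])) = cl (elt [1, 3])" "cl (elt (w0 @ [1, 3])) = cl (elt [1])"
    unfolding W_def cl_def by (rule conj_class_w0_1 conj_class_w0_13)+
  moreover have "elt w0 \<in> carrier W" "\<forall>x\<in>carrier W. elt w0 \<otimes>\<^bsub>W\<^esub> x = x \<otimes>\<^bsub>W\<^esub> elt w0"
    unfolding W_def using elt_w0_central by simp_all
  ultimately show ?thesis
    unfolding w by (simp add: reflection_rep_w0 elt_w0_sq)
qed

end
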